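(* Let $\alpha\in\mathbb Z\setminus\{-1,0\}$ and let $(h_n)$ be the sequence with $h_0=0$, $h_1=1$, $h_2=-\alpha(\alpha+1)$, $h_3=-\alpha^3(\alpha+1)^3$, $h_4=\alpha^6(\alpha+1)^5$, and for $m\ge2$: $h_{2m+1}=h_{m+2}h_m^3-h_{m-1}h_{m+1}^3$, for $m\ge 3$: $h_{2m}=h_m\big(h_{m+2}h_{m-1}^2-h_{m-2}h_{m+1}^2\big)/h_2$. (i) If $n\equiv 2,3,9,10\pmod{12}$, then $h_n$ is not a square. (ii) If $n\equiv 2,5,7,11,13,16\pmod{18}$, then $h_n$ is not a cube.
   Context: The sequence defined is the elliptic divisibility sequence attached to the point $(0,0)$ of order $6$ on the Tate normal form curve with $b=\alpha+\alpha^2$, $c=\alpha$. Convention: an integer $m$ is called a square if $m=\pm\beta^2$ for some nonzero integer $\beta$, and a cube if $m=\beta^3$ for some nonzero integer $\beta$. *)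

theory Defs
  imports Complex_Main
begin

text \<open>
  Squares are taken up to sign, and zero counts neither as a square nor as a cube.
\<close>

definition signed_square :: "int \<Rightarrow> bool" where
  "signed_square m \<longleftrightarrow> (\<exists>\<beta>::int. \<beta> \<noteq> 0 \<and> (m = \<beta>^2 \<or> m = - (\<beta>^2)))"

definition nonzero_cube :: "int \<Rightarrow> bool" where
  "nonzero_cube m \<longleftrightarrow> (\<exists>\<beta>::int. \<beta> \<noteq> 0 \<and> m = \<beta>^3)"

end

theory Submission
  imports Defs "HOL-Computational_Algebra.Nth_Powers"
begin

text \<open>
  With \<open>c = -\<alpha>\<^sup>5 (\<alpha> + 1)\<^sup>4\<close> the sequence satisfies \<open>h\<^bsub>n+6\<^esub> = -c\<^bsup>n+3\<^esup> h\<^sub>n\<close>. Hence, up to sign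
  and \<open>k\<close>-th powers, \<open>h\<^sub>n\<close> depends only on \<open>n\<close> modulo \<open>6k\<close>, and for the residues in question it is a
  product of powers of \<open>\<alpha>\<close> and \<open>\<alpha> + 1\<close> whose exponents are coprime to \<open>k\<close>. If such a product were a
  \<open>k\<close>-th power up to sign, the consecutive positive integers \<open>|\<alpha>|\<close> and \<open>|\<alpha> + 1|\<close> would both be
  \<open>k\<close>-th powers.
\<close>

section \<open>Powers of consecutive integers\<close>

text \<open>For each prime p, n divides k times the multiplicity of p in \<open>x\<close>.
  Coprimality removes the factor k.\<close>

lemma is_nth_power_of_power_coprime_nat:
  fixes x :: nat
  assumes "n > 0" "coprime n k" "is_nth_power n (x ^ k)"
  shows "is_nth_power n x"
proof (cases "x = 0")
  case True
  then show ?thesis using \<open>n > 0\<close> by simp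
next
  case False
  show ?thesis
    unfolding is_nth_power_conv_multiplicity_nat[OF \<open>n > 0\<close>]
  proof safe
    fix p :: nat assume p: "prime p"
    then have "n dvd multiplicity p (x ^ k)"
      using assms is_nth_power_conv_multiplicity_nat by blast
    also have "multiplicity p (x ^ k) = k * multiplicity p x"
      using p False by (simp add: prime_elem_multiplicity_power_distrib)
    finally show "n dvd multiplicity p x"
      using \<open>coprime n k\<close> by (simp add: coprime_dvd_mult_right_iff)
  qed
qed

text \<open>The gap between u^n and (u + 1)^n exceeds 1 as soon as n \<ge> 2 and u > 0, so two
  positive n-th powers cannot be adjacent.\<close>

lemma not_is_nth_power_Suc:
  fixes x :: nat
  assumes "n \<ge> 2" "x > 0" "is_nth_power n x"
  shows "\<not> is_nth_power n (Suc x)"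
proof
  assume "is_nth_power n (Suc x)"
  then obtain u v where u: "x = u ^ n" and v: "Suc x = v ^ n"
    using assms(3) by (auto elim!: is_nth_powerE)
  have "u > 0"
    using u assms by (cases u) auto
  have "u ^ n < v ^ n"
    using u v by simp
  then have "Suc u \<le> v"
    using power_less_imp_less_base[of u n v] by simp
  then have "Suc u ^ n \<le> u ^ n + 1"
    using u v power_mono[of "Suc u" v n] by simp
  moreover obtain k where k: "n = Suc (Suc k)"
    using \<open>n \<ge> 2\<close> by (metis add_2_eq_Suc le_Suc_ex)
  have "u ^ Suc k < Suc u ^ Suc k"
    by (rule power_strict_mono) auto
  then have "u * u ^ Suc k + 1 < Suc u * Suc u ^ Suc k"
    using \<open>u > 0\<close> mult_le_mono2[of "u ^ Suc k + 1" "Suc u ^ Suc k" "Suc u"]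
    by (simp add: algebra_simps)
  ultimately show False
    using k by simp
qed

lemma not_is_nth_power_consecutive_nat:
  fixes x :: nat
  assumes "n \<ge> 2" "x > 0" "coprime n i" "coprime n j"
  shows "\<not> is_nth_power n (x ^ i * Suc x ^ j)"
proof
  assume "is_nth_power n (x ^ i * Suc x ^ j)"
  moreover have "coprime (x ^ i) (Suc x ^ j)"
    by simp
  ultimately have "is_nth_power n (x ^ i)" "is_nth_power n (Suc x ^ j)"
    using is_nth_power_mult_coprime_nat_iff by blast+
  then have "is_nth_power n x" "is_nth_power n (Suc x)"
    using assms by (auto intro: is_nth_power_of_power_coprime_nat simp del: power_Suc)
  then show False
    using assms not_is_nth_power_Suc by blast
qed

lemma not_is_nth_power_consecutive_int:
  fixes a :: int
  assumes "n \<ge> 2" "a \<noteq> 0" "a \<noteq> -1" "coprime n i" "coprime n j"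
  shows "\<not> is_nth_power n \<bar>a ^ i * (a + 1) ^ j\<bar>"
proof
  assume "is_nth_power n \<bar>a ^ i * (a + 1) ^ j\<bar>"
  then obtain y where "\<bar>a ^ i * (a + 1) ^ j\<bar> = y ^ n"
    by (auto elim: is_nth_powerE)
  then have "nat \<bar>a ^ i * (a + 1) ^ j\<bar> = nat \<bar>y\<bar> ^ n"
    by (metis abs_abs nat_power_eq power_abs abs_ge_zero)
  then have *: "is_nth_power n (nat \<bar>a\<bar> ^ i * nat \<bar>a + 1\<bar> ^ j)"
    by (auto simp: abs_mult power_abs nat_mult_distrib nat_power_eq intro: is_nth_powerI)
  show False
  proof (cases "a > 0")
    case True
    then have "nat \<bar>a + 1\<bar> = Suc (nat \<bar>a\<bar>)"
      by simp
    then show False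
      using * True assms not_is_nth_power_consecutive_nat[of n "nat \<bar>a\<bar>" i j] by simp
  next
    case False
    \<comment> \<open>For negative \<open>a\<close> the smaller of the two absolute values is that
      of \<open>a + 1\<close>, so the exponents swap roles; \<open>a \<noteq> -1\<close> keeps it
      positive.\<close>
    then have "nat \<bar>a\<bar> = Suc (nat \<bar>a + 1\<bar>)" "nat \<bar>a + 1\<bar> > 0"
      using assms by auto
    then show False
      using * assms not_is_nth_power_consecutive_nat[of n "nat \<bar>a + 1\<bar>" j i]
      by (simp add: mult.commute)
  qed
qed

section \<open>The sequence of the point of order six\<close>

text \<open>A separate letter \<open>b\<close> for \<alpha> + 1 lets the values be written as
  monomials in \<open>a\<close> and \<open>b\<close>. The even recurrence is cleared of its
  denominator.\<close>

locale order_six_eds =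
  fixes a b :: int and h :: "nat \<Rightarrow> int"
  assumes b_eq: "b = a + 1" and a_nz: "a \<noteq> 0" and b_nz: "b \<noteq> 0"
    and h0: "h 0 = 0" and h1: "h 1 = 1" and h2: "h 2 = - (a * b)"
    and h3: "h 3 = - (a ^ 3 * b ^ 3)" and h4: "h 4 = a ^ 6 * b ^ 5"
    and odd_rec: "m \<ge> 2 \<Longrightarrow> h (2 * m + 1) = h (m + 2) * h m ^ 3 - h (m - 1) * h (m + 1) ^ 3"
    and even_rec: "m \<ge> 3 \<Longrightarrow>
      h (2 * m) * h 2 = h m * (h (m + 2) * h (m - 1) ^ 2 - h (m - 2) * h (m + 1) ^ 2)"
begin

section \<open>Explicit values up to index 16\<close>

lemma h2_nz: "h 2 \<noteq> 0"
  using h2 a_nz b_nz by simp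

lemma h5: "h 5 = a ^ 10 * b ^ 8"
proof -
  have "h 5 = h 4 * h 2 ^ 3 - h 1 * h 3 ^ 3"
    using odd_rec[of 2] by (simp add: eval_nat_numeral)
  \<comment> \<open>The right-hand side is a^9 b^8 (b - 1), and b - 1 = a makes it a
    monomial.\<close>
  then show ?thesis
    unfolding h1 h2 h3 h4 using b_eq by algebra
qed

text \<open>This reflects the order 6 of the point: both terms in the bracket equal a^12 b^10. From
  index 8 on, this zero leaves at most one term in each recurrence below.\<close>

lemma h6: "h 6 = 0"
proof -
  have "h 6 * h 2 = h 3 * (h 5 * h 2 ^ 2 - h 1 * h 4 ^ 2)"
    using even_rec[of 3] by simp
  also have "\<dots> = 0 * h 2"
    unfolding h1 h2 h3 h4 h5 by algebra
  finally show ?thesis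
    by (rule mult_right_cancel[OF h2_nz, THEN iffD1])
qed

lemma h7: "h 7 = - (a ^ 20 * b ^ 16)"
proof -
  have "h 7 = h 5 * h 3 ^ 3 - h 2 * h 4 ^ 3"
    using odd_rec[of 3] by simp
  then show ?thesis
    unfolding h2 h3 h4 h5 using b_eq by algebra
qed

lemma h8: "h 8 = - (a ^ 26 * b ^ 21)"
proof -
  have "h 8 * h 2 = h 4 * (h 6 * h 3 ^ 2 - h 2 * h 5 ^ 2)"
    using even_rec[of 4] by simp
  also have "\<dots> = - (a ^ 26 * b ^ 21) * h 2"
    unfolding h2 h3 h4 h5 h6 by algebra
  finally show ?thesis
    by (rule mult_right_cancel[OF h2_nz, THEN iffD1])
qed

lemma h9: "h 9 = a ^ 33 * b ^ 27"
proof -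
  have "h 9 = h 6 * h 4 ^ 3 - h 3 * h 5 ^ 3"
    using odd_rec[of 4] by simp
  then show ?thesis
    unfolding h3 h4 h5 h6 by algebra
qed

lemma h10: "h 10 = a ^ 41 * b ^ 33"
proof -
  have "h 10 * h 2 = h 5 * (h 7 * h 4 ^ 2)"
    using even_rec[of 5] h6 by simp
  also have "\<dots> = (a ^ 41 * b ^ 33) * h 2"
    unfolding h2 h4 h5 h7 by algebra
  finally show ?thesis
    by (rule mult_right_cancel[OF h2_nz, THEN iffD1])
qed

lemma h11: "h 11 = - (a ^ 50 * b ^ 40)"
proof -
  have "h 11 = h 7 * h 5 ^ 3"
    using odd_rec[of 5] h6 by simp
  then show ?thesis
    unfolding h5 h7 by algebra
qed

lemma h12: "h 12 = 0"
  using even_rec[of 6] h2_nz h6 by simp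

lemma h13: "h 13 = a ^ 70 * b ^ 56"
proof -
  have "h 13 = - (h 5 * h 7 ^ 3)"
    using odd_rec[of 6] h6 by simp
  then show ?thesis
    unfolding h5 h7 by algebra
qed

lemma h14: "h 14 = - (a ^ 81 * b ^ 65)"
proof -
  have "h 14 * h 2 = h 7 * - (h 5 * h 8 ^ 2)"
    using even_rec[of 7] h6 by simp
  also have "\<dots> = - (a ^ 81 * b ^ 65) * h 2"
    unfolding h2 h5 h7 h8 by algebra
  finally show ?thesis
    by (rule mult_right_cancel[OF h2_nz, THEN iffD1])
qed

lemma h15: "h 15 = - (a ^ 93 * b ^ 75)"
proof -
  have "h 15 = h 9 * h 7 ^ 3 - h 6 * h 8 ^ 3"
    using odd_rec[of 7] by simp
  then show ?thesis
    unfolding h6 h7 h8 h9 by algebra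
qed

lemma h16: "h 16 = a ^ 106 * b ^ 85"
proof -
  have "h 16 * h 2 = h 8 * (h 10 * h 7 ^ 2 - h 6 * h 9 ^ 2)"
    using even_rec[of 8] by simp
  also have "\<dots> = (a ^ 106 * b ^ 85) * h 2"
    unfolding h2 h6 h7 h8 h9 h10 by algebra
  finally show ?thesis
    using h2_nz by simp
qed

section \<open>The shift by six\<close>

definition c :: int where "c = - (a ^ 5 * b ^ 4)"

lemma c_nz: "c \<noteq> 0"
  using a_nz b_nz by (simp add: c_def)

text \<open>The values \<open>h 7\<close> and \<open>h 8\<close> determine \<open>c\<close>: the
  former gives c^4 = a^20 b^16, the latter fixes the sign. These eleven cases are the base of the
  induction in \<open>shift_6\<close>.\<close>

lemma shift_6_small:
  assumes "n < 11"
  shows "h (n + 6) = - (c ^ (n + 3) * h n)"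
proof -
  note hs = h0 h1 h2 h3 h4 h5 h6 h7 h8 h9 h10 h11 h12 h13 h14 h15 h16
  have "h 6 = - (c ^ 3 * h 0)" "h 7 = - (c ^ 4 * h 1)" "h 8 = - (c ^ 5 * h 2)"
    "h 9 = - (c ^ 6 * h 3)" "h 10 = - (c ^ 7 * h 4)" "h 11 = - (c ^ 8 * h 5)"
    "h 12 = - (c ^ 9 * h 6)" "h 13 = - (c ^ 10 * h 7)" "h 14 = - (c ^ 11 * h 8)"
    "h 15 = - (c ^ 12 * h 9)" "h 16 = - (c ^ 13 * h 10)"
    unfolding hs c_def by algebra+
  moreover have "n \<in> {0, 1, 2, 3, 4, 5, 6, 7, 8, 9, 10}"
    using assms by (simp add: less_Suc_eq eval_nat_numeral)
  ultimately show ?thesis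
    by auto
qed

text \<open>Both terms of the recurrence are products of four values whose indices sum to 4m.
  Shifting each factor by 6 thus extracts the same power of \<open>c\<close> from both, and the four
  signs cancel.\<close>

lemma shift_12_even:
  assumes "m \<ge> 3" and shift: "\<And>i. i \<le> m + 2 \<Longrightarrow> h (i + 6) = - (c ^ (i + 3) * h i)"
  shows "h (2 * m + 12) = c ^ (4 * m + 12) * h (2 * m)"
proof -
  obtain k where k: "m = k + 3"
    using \<open>m \<ge> 3\<close> by (metis add.commute le_Suc_ex)
  \<comment> \<open>Hiding the symbolic exponent leaves identities with numeral exponents, which
    \<open>algebra\<close> can treat.\<close>
  obtain y where y: "y = c ^ k"
    by blast
  have s: "h (k + 1 + 6) = - (y * c ^ 4 * h (k + 1))"
      "h (k + 2 + 6) = - (y * c ^ 5 * h (k + 2))"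
      "h (k + 3 + 6) = - (y * c ^ 6 * h (k + 3))"
      "h (k + 4 + 6) = - (y * c ^ 7 * h (k + 4))"
      "h (k + 5 + 6) = - (y * c ^ 8 * h (k + 5))"
    using shift[of "k + 1"] shift[of "k + 2"] shift[of "k + 3"] shift[of "k + 4"] shift[of "k + 5"]
    by (simp_all add: k y power_add mult.assoc eval_nat_numeral)
  have "h (2 * m + 12) * h 2 = h (2 * (m + 6)) * h 2"
    by (simp add: algebra_simps)
  also have "\<dots> = h (k + 3 + 6) * (h (k + 5 + 6) * h (k + 2 + 6) ^ 2 - h (k + 1 + 6) * h (k + 4 + 6) ^ 2)"
    by (subst even_rec) (simp_all add: k)
  also have "\<dots> = y ^ 4 * c ^ 24 *
      (h (k + 3) * (h (k + 5) * h (k + 2) ^ 2 - h (k + 1) * h (k + 4) ^ 2))"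
    unfolding s by algebra
  also have "\<dots> = y ^ 4 * c ^ 24 * (h (2 * m) * h 2)"
    using even_rec[OF \<open>m \<ge> 3\<close>] by (simp add: k eval_nat_numeral)
  also have "y ^ 4 * c ^ 24 = c ^ (4 * m + 12)"
    by (simp add: y k algebra_simps flip: power_mult power_add)
  finally show ?thesis
    using h2_nz by simp
qed

text \<open>The argument is that of the even case, with index sum 4m + 2 in both terms.\<close>

lemma shift_12_odd:
  assumes "m \<ge> 2" and shift: "\<And>i. i \<le> m + 2 \<Longrightarrow> h (i + 6) = - (c ^ (i + 3) * h i)"
  shows "h (2 * m + 1 + 12) = c ^ (4 * m + 14) * h (2 * m + 1)"
proof -
  obtain k where k: "m = k + 2"
    using \<open>m \<ge> 2\<close> by (metis add.commute le_Suc_ex)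
  obtain y where y: "y = c ^ k"
    by blast
  have s: "h (k + 1 + 6) = - (y * c ^ 4 * h (k + 1))"
      "h (k + 2 + 6) = - (y * c ^ 5 * h (k + 2))"
      "h (k + 3 + 6) = - (y * c ^ 6 * h (k + 3))"
      "h (k + 4 + 6) = - (y * c ^ 7 * h (k + 4))"
    using shift[of "k + 1"] shift[of "k + 2"] shift[of "k + 3"] shift[of "k + 4"]
    by (simp_all add: k y power_add mult.assoc eval_nat_numeral)
  have "h (2 * m + 1 + 12) = h (2 * (m + 6) + 1)"
    by (simp add: algebra_simps)
  also have "\<dots> = h (k + 4 + 6) * h (k + 2 + 6) ^ 3 - h (k + 1 + 6) * h (k + 3 + 6) ^ 3"
    by (subst odd_rec) (simp_all add: k)
  also have "\<dots> = y ^ 4 * c ^ 22 * (h (k + 4) * h (k + 2) ^ 3 - h (k + 1) * h (k + 3) ^ 3)"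
    unfolding s by algebra
  also have "\<dots> = y ^ 4 * c ^ 22 * h (2 * m + 1)"
    using odd_rec[OF \<open>m \<ge> 2\<close>] by (simp add: k eval_nat_numeral)
  also have "y ^ 4 * c ^ 22 = c ^ (4 * m + 14)"
    by (simp add: y k algebra_simps flip: power_mult power_add)
  finally show ?thesis .
qed

text \<open>
  Doubling an index doubles a shift, so the shifts by \<open>6\<close> around \<open>p div 2\<close> give the shift by \<open>12\<close>
  at \<open>p\<close>. Expressing \<open>h\<^sub>p\<close> through the shift by \<open>6\<close> at \<open>p\<close> turns it into the shift by \<open>6\<close> at \<open>p + 6\<close>.
\<close>

lemma shift_6: "h (n + 6) = - (c ^ (n + 3) * h n)"
proof (induction n rule: less_induct)
  case (less n)
  show ?case
  proof (cases "n < 11")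
    case True
    then show ?thesis by (rule shift_6_small)
  next
    case False
    \<comment> \<open>The bound \<open>p \<ge> 5\<close> puts \<open>p div 2\<close> in the range of
      the recurrences: at least 2 for odd \<open>p\<close>, at least 3 for even \<open>p\<close>.
      All shifts needed lie below \<open>p + 6\<close>.\<close>
    then have "n = (n - 6) + 6" "n - 6 \<ge> 5"
      by auto
    then obtain p where p: "n = p + 6" "p \<ge> 5"
      by blast
    have shift: "h (i + 6) = - (c ^ (i + 3) * h i)" if "i \<le> p div 2 + 2" for i
      using that p by (intro less.IH) linarith
    have "h (p + 12) = c ^ (2 * p + 12) * h p"
    proof (cases "even p")
      case True
      then show ?thesis
        using shift_12_even[of "p div 2"] shift p by fastforce
    next
      case False
      then have "p = 2 * (p div 2) + 1"
        by simp
      then obtain m where m: "p = 2 * m + 1" "p div 2 = m"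
        by blast
      then show ?thesis
        using shift_12_odd[of m] shift p by (simp add: algebra_simps)
    qed
    moreover have "h n = - (c ^ (p + 3) * h p)"
      using less.IH[of p] p by simp
    ultimately show ?thesis
      using p by (simp add: algebra_simps flip: power_add)
  qed
qed

section \<open>Reduction to finitely many residues\<close>

text \<open>The exponent is the sum of 6j + n + 3 over j < k.\<close>

lemma abs_shift: "\<bar>h (6 * k + n)\<bar> = \<bar>c\<bar> ^ (k * (3 * k + n)) * \<bar>h n\<bar>"
proof (induction k)
  case (Suc k)
  have "\<bar>h (6 * Suc k + n)\<bar> = \<bar>h (6 * k + n + 6)\<bar>"
    by (simp add: algebra_simps)
  also have "\<dots> = \<bar>c\<bar> ^ (6 * k + n + 3) * (\<bar>c\<bar> ^ (k * (3 * k + n)) * \<bar>h n\<bar>)"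
    by (simp add: shift_6 abs_mult power_abs Suc.IH)
  also have "\<dots> = \<bar>c\<bar> ^ (Suc k * (3 * Suc k + n)) * \<bar>h n\<bar>"
    by (simp add: algebra_simps flip: power_add)
  finally show ?case .
qed simp

text \<open>Over \<open>d * k\<close> shifts by 6 the exponent of |c| is a multiple of
  \<open>d\<close>, so a nonzero d-th power cancels.\<close>

lemma is_nth_power_shift:
  "is_nth_power d \<bar>h (6 * d * k + n)\<bar> \<longleftrightarrow> is_nth_power d \<bar>h n\<bar>"
proof -
  have "\<bar>h (6 * d * k + n)\<bar> = \<bar>c\<bar> ^ (d * (k * (3 * (d * k) + n))) * \<bar>h n\<bar>"
    using abs_shift[of "d * k" n] by (simp add: mult.assoc)
  then show ?thesis
    using c_nz by (simp add: is_nth_power_mult_cancel_left is_nth_power_nth_power')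
qed

lemma not_is_nth_power_monomial:
  assumes "d \<ge> 2" "coprime d i" "coprime d j" "\<bar>h n\<bar> = \<bar>a ^ i * b ^ j\<bar>"
  shows "\<not> is_nth_power d \<bar>h (6 * d * k + n)\<bar>"
  using assms not_is_nth_power_consecutive_int[of d a i j] a_nz b_nz b_eq
  by (auto simp: is_nth_power_shift)

lemma not_signed_square:
  assumes "n mod 12 \<in> {2, 3, 9, 10}"
  shows "\<not> signed_square (h n)"
proof
  assume "signed_square (h n)"
  then have *: "is_nth_power 2 \<bar>h n\<bar>"
    by (auto simp: signed_square_def)
  have n: "n = 6 * 2 * (n div 12) + n mod 12"
    by simp
  \<comment> \<open>For these residues both exponents of the monomial are odd.\<close>
  have "\<not> is_nth_power 2 \<bar>h (6 * 2 * k + r)\<bar>" if "r \<in> {2, 3, 9, 10}" for k r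
    using that not_is_nth_power_monomial[of 2 1 1 2 k] not_is_nth_power_monomial[of 2 3 3 3 k]
      not_is_nth_power_monomial[of 2 33 27 9 k] not_is_nth_power_monomial[of 2 41 33 10 k]
    by (auto simp: h2 h3 h9 h10)
  with assms * n show False
    by metis
qed

lemma not_nonzero_cube:
  assumes "n mod 18 \<in> {2, 5, 7, 11, 13, 16}"
  shows "\<not> nonzero_cube (h n)"
proof
  assume "nonzero_cube (h n)"
  then have *: "is_nth_power 3 \<bar>h n\<bar>"
    by (auto simp: nonzero_cube_def power_abs)
  have coprime_3: "coprime 3 i" if "\<not> 3 dvd i" for i :: nat
    using that by (intro prime_imp_coprime) simp_all
  have n: "n = 6 * 3 * (n div 18) + n mod 18"
    by simp
  \<comment> \<open>For these residues neither exponent is divisible by 3.\<close>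
  have "\<not> is_nth_power 3 \<bar>h (6 * 3 * k + r)\<bar>" if "r \<in> {2, 5, 7, 11, 13, 16}" for k r
    using that not_is_nth_power_monomial[of 3 1 1 2 k] not_is_nth_power_monomial[of 3 10 8 5 k]
      not_is_nth_power_monomial[of 3 20 16 7 k] not_is_nth_power_monomial[of 3 50 40 11 k]
      not_is_nth_power_monomial[of 3 70 56 13 k] not_is_nth_power_monomial[of 3 106 85 16 k]
    by (auto simp: h2 h5 h7 h11 h13 h16 coprime_3)
  with assms * n show False
    by metis
qed

end

theorem theorem5p7:
  fixes \<alpha> :: int and h :: "nat \<Rightarrow> int"
  assumes "\<alpha> \<notin> {-1, 0}"
    and "h 0 = 0"
    and "h 1 = 1"
    and "h 2 = - (\<alpha> * (\<alpha> + 1))"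
    and "h 3 = - (\<alpha>^3 * (\<alpha> + 1)^3)"
    and "h 4 = \<alpha>^6 * (\<alpha> + 1)^5"
    and "\<And>m. m \<ge> 2 \<Longrightarrow>
      h (2 * m + 1) = h (m + 2) * h m ^ 3 - h (m - 1) * h (m + 1) ^ 3"
    and "\<And>m. m \<ge> 3 \<Longrightarrow>
      (of_int (h (2 * m)) :: rat) =
        of_int (h m * (h (m + 2) * h (m - 1) ^ 2 - h (m - 2) * h (m + 1) ^ 2)) / of_int (h 2)"
  shows "(\<forall>n. n mod 12 \<in> {2, 3, 9, 10} \<longrightarrow> \<not> signed_square (h n)) \<and>
         (\<forall>n. n mod 18 \<in> {2, 5, 7, 11, 13, 16} \<longrightarrow> \<not> nonzero_cube (h n))"
proof -
  have nz: "\<alpha> \<noteq> 0" "\<alpha> + 1 \<noteq> 0"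
    using assms(1) by auto
  have even_rec: "h (2 * m) * h 2 = h m * (h (m + 2) * h (m - 1) ^ 2 - h (m - 2) * h (m + 1) ^ 2)"
    (is "_ = ?R") if "m \<ge> 3" for m
  proof -
    \<comment> \<open>The division is stated in the rationals; multiplying by the nonzero
      \<open>h 2\<close> returns the identity to the integers.\<close>
    have "(of_int (h 2) :: rat) \<noteq> 0"
      using assms(4) nz by simp
    then have "(of_int (h (2 * m)) :: rat) * of_int (h 2) = of_int ?R"
      using assms(8)[OF that] by simp
    then show ?thesis
      by (simp only: of_int_mult[symmetric] of_int_eq_iff)
  qed
  interpret order_six_eds \<alpha> "\<alpha> + 1" h
    using assms(2-7) nz even_rec by unfold_locales auto
  show ?thesis
    using not_signed_square not_nonzero_cube by blast
qed

end
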